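(* Let $P$ be a parallelogram and $T$ a triangle in the Euclidean plane $E^2$. Then $\delta_{BM}^{\rm cen}(P,T)=\frac{5}{2}$.
   Context: For convex bodies $C,D\subset E^d$, the centroid Banach–Mazur distance is $$\delta_{BM}^{\rm cen}(C,D)=\inf_{a,\,h_\lambda}\{\lambda:\ a(D)\subset C\subset h_\lambda(a(D))\ \text{and}\ {\rm cen}(a(D))={\rm cen}(C)\},$$ where $a$ ranges over (non-degenerate) affine transformations of $E^d$, ${\rm cen}(X)$ denotes the centroid (center of mass) of $X$, and $h_\lambda$ is the homothety with ratio $\lambda\ge 1$ whose center is the common centroid ${\rm cen}(a(D))={\rm cen}(C)$. *)

theory Defs
  imports "HOL-Analysis.Analysis"
begin

definition cen :: "(real^2) set \<Rightarrow> real^2" where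
  "cen X = (1 / measure lebesgue X) *\<^sub>R integral X (\<lambda>x. x)"

definition nondeg_affine :: "(real^2 \<Rightarrow> real^2) \<Rightarrow> bool" where
  "nondeg_affine a \<longleftrightarrow> (\<exists>f b. linear f \<and> inj f \<and> a = (\<lambda>x. f x + b))"

definition homothety :: "real^2 \<Rightarrow> real \<Rightarrow> real^2 \<Rightarrow> real^2" where
  "homothety c lam x = c + lam *\<^sub>R (x - c)"

definition cen_BM :: "(real^2) set \<Rightarrow> (real^2) set \<Rightarrow> real" where
  "cen_BM C D = Inf {lam. lam \<ge> 1 \<and> (\<exists>a. nondeg_affine a \<and> a ` D \<subseteq> C
       \<and> C \<subseteq> homothety (cen (a ` D)) lam ` (a ` D) \<and> cen (a ` D) = cen C)}"

definition parallelogram :: "(real^2) set \<Rightarrow> bool" where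
  "parallelogram P \<longleftrightarrow> (\<exists>p u v. \<not> collinear {p, p + u, p + v}
      \<and> P = convex hull {p, p + u, p + v, p + u + v})"

definition triangle :: "(real^2) set \<Rightarrow> bool" where
  "triangle T \<longleftrightarrow> (\<exists>a b c. \<not> collinear {a, b, c} \<and> T = convex hull {a, b, c})"

end

theory Submission
  imports Defs
begin

text \<open>
  In affine coordinates \<open>P\<close> is the square \<open>[-1,1]\<^sup>2\<close> and the image of \<open>T\<close> is a triangle in it with
  vertices \<open>v1\<close>, \<open>v2\<close>, \<open>v3\<close> of sum 0. Put \<open>D = det (v1, v2)\<close>. If \<open>lam\<close> times the triangle covers the
  square, then every side has l1-length at most \<open>lam * \<bar>D\<bar>\<close>, because the l1-norm is up to a rotation
  the support function of the square. It remains to show that the longest side in the l1-norm is at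
  least \<open>5/2 * \<bar>D\<bar>\<close>. Some vertex of the triangle is a corner of its bounding box, and with the origin
  moved to it this is an inequality for the two edge vectors. Equality holds for the triangle
  with vertices \<open>(-1, -1/2)\<close>, \<open>(1, -1/2)\<close>, \<open>(0, 1)\<close>. Centroids are found from symmetry: they are
  equivariant under affine maps.
\<close>

section \<open>Triangles in the square with centroid at its centre\<close>

text \<open>This is the case \<open>w = (3 + q) / 2\<close>, \<open>h = (3 + p) / 2\<close> of the
  extremal triangles, where \<open>5 / 6 * (w * h - p * q)\<close> becomes the left side. The bounds
  on \<open>M\<close> are \<open>h + q <= M\<close> and
  \<open>(w - q) + (h - p) <= M\<close>.\<close>

lemma corner_ineq_p_le_q:
  fixes p q M :: real
  assumes "0 \<le> p" "p \<le> q" "q \<le> 1" "(3 + p) / 2 + q \<le> M" "3 - (p + q) / 2 \<le> M"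
  shows "5 / 8 * (3 + p + q - p * q) \<le> M"
proof (cases "p \<le> 3/5")
  case True
  \<comment> \<open>The weights have sum 12 and are chosen so that the terms in \<open>q\<close>
    agree with those of 12 times the claim. What remains is \<open>p * (3 - 5 * p)\<close>,
    nonnegative exactly up to \<open>p = 3/5\<close>.\<close>
  have "(9 - 5 * p) * ((3 + p) / 2 + q) \<le> (9 - 5 * p) * M"
       "(3 + 5 * p) * (3 - (p + q) / 2) \<le> (3 + 5 * p) * M"
    using assms by (auto intro!: mult_left_mono)
  moreover have "0 \<le> p * (18 - 30 * p)" using True assms by simp
  ultimately show ?thesis by (simp add: field_simps)
next
  case False
  \<comment> \<open>Both factors are now at least \<open>3/5\<close>; these lower bounds for
    \<open>p * q\<close> make the claim linear.\<close>
  have "(3/5) * q \<le> p * q" using False assms by (intro mult_right_mono) auto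
  moreover have "p * (3/5) \<le> p * q" using False assms by (intro mult_left_mono) auto
  ultimately show ?thesis using False assms by argo
qed

text \<open>Case \<open>w = 3 - q\<close>, \<open>h = (3 + p) / 2\<close>. The left side equals
  \<open>5/4 * (3 - q - p * (q - 1))\<close>, which is at most \<open>5/2\<close>, and
  \<open>M\<close> is at least \<open>5/2\<close>.\<close>

lemma corner_ineq_p_le_1_le_q:
  fixes p q M :: real
  assumes "0 \<le> p" "1 \<le> q" "(3 + p) / 2 + q \<le> M"
  shows "5 / 6 * ((3 - q) * ((3 + p) / 2) - p * q) \<le> M"
proof -
  have "0 \<le> p * (q - 1)" using assms by simp
  then show ?thesis using assms by (simp add: field_simps)
qed

text \<open>Case \<open>w = 3 - q\<close>, \<open>h = 3 - p\<close>. The products cancel and leave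
  \<open>5/2 * (3 - p - q) <= 5/2\<close>, while averaging the two bounds gives
  \<open>M >= 3\<close>.\<close>

lemma corner_ineq_1_le_p_q:
  fixes p q M :: real
  assumes "1 \<le> p" "1 \<le> q" "3 - q + p \<le> M" "3 - p + q \<le> M"
  shows "5 / 6 * ((3 - q) * (3 - p) - p * q) \<le> M"
  using assms by (simp add: field_simps)

text \<open>With \<open>w\<close> and \<open>h\<close> maximal only \<open>p\<close> and
  \<open>q\<close> are free. The minima switch at \<open>q = 1\<close> and \<open>p = 1\<close>, and
  exchanging the axes reduces the five cases to the three above.\<close>

lemma corner_ineq_extremal:
  fixes w h p q M :: real
  assumes pq: "0 \<le> p" "0 \<le> q"
    and w: "w = min ((3 + q) / 2) (3 - q)" and h: "h = min ((3 + p) / 2) (3 - p)"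
    and M: "w + p \<le> M" "h + q \<le> M" "(w - q) + (h - p) \<le> M"
  shows "5 / 6 * (w * h - p * q) \<le> M"
proof -
  have w1: "w = (3 + q) / 2" if "q \<le> 1" using w that by auto
  have w2: "w = 3 - q" if "1 \<le> q" using w that by auto
  have h1: "h = (3 + p) / 2" if "p \<le> 1" using h that by auto
  have h2: "h = 3 - p" if "1 \<le> p" using h that by auto
  consider "q \<le> 1" "p \<le> q" | "p \<le> 1" "q \<le> p" | "1 \<le> q" "p \<le> 1" | "1 \<le> p" "q \<le> 1" | "1 \<le> p" "1 \<le> q"
    by linarith
  then show ?thesis
  proof cases
    case 1
    then have e: "w = (3 + q) / 2" "h = (3 + p) / 2" using w1 h1 by auto
    have "5 / 8 * (3 + p + q - p * q) \<le> M"
      using 1 pq M unfolding e by (intro corner_ineq_p_le_q) argo+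
    then show ?thesis unfolding e by (simp add: field_simps)
  next
    case 2
    then have e: "w = (3 + q) / 2" "h = (3 + p) / 2" using w1 h1 by auto
    have "5 / 8 * (3 + q + p - q * p) \<le> M"
      using 2 pq M unfolding e by (intro corner_ineq_p_le_q) argo+
    then show ?thesis unfolding e by (simp add: field_simps)
  next
    case 3
    then have e: "w = 3 - q" "h = (3 + p) / 2" using w2 h1 by auto
    show ?thesis using corner_ineq_p_le_1_le_q[of p q M] 3 pq M unfolding e by blast
  next
    case 4
    then have e: "w = (3 + q) / 2" "h = 3 - p" using w1 h2 by auto
    show ?thesis using corner_ineq_p_le_1_le_q[of q p M] 4 pq M unfolding e by (simp only: mult.commute)
  next
    case 5
    then have e: "w = 3 - q" "h = 3 - p" using w2 h2 by auto
    show ?thesis using corner_ineq_1_le_p_q[of p q M] 5 M unfolding e by blast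
  qed
qed

text \<open>Lengthening \<open>w\<close> by some amount raises the right side by that amount and the
  left side by \<open>5/6 * h\<close> times it. For \<open>h >= 6/5\<close> the left side gains at
  least as much, so the longer triangle has the stronger inequality.\<close>

lemma corner_ineq_enlarge:
  fixes w W h p q M :: real
  assumes "6 / 5 \<le> h" "w \<le> W" "5 / 6 * (W * h - p * q) \<le> M + (W - w)"
  shows "5 / 6 * (w * h - p * q) \<le> M"
proof -
  have "(W - w) * (6/5) \<le> (W - w) * h" using assms by (intro mult_left_mono) auto
  then show ?thesis using assms by (simp add: field_simps)
qed

lemma corner_ineq_flat:
  fixes w h p q M :: real
  assumes "0 \<le> p" "0 \<le> q" "0 \<le> w" "w + p \<le> M" "h \<le> 6 / 5"
  shows "5 / 6 * (w * h - p * q) \<le> M"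
proof -
  have "w * h \<le> w * (6/5)" using assms by (intro mult_left_mono)
  moreover have "0 \<le> p * q" using assms by simp
  ultimately show ?thesis using assms by argo
qed

text \<open>The triangle has the vertices \<open>(0, 0)\<close>, \<open>(w, p)\<close>, \<open>(q, h)\<close>, and \<open>M\<close> bounds the l1-lengths of its
  sides. The bounds for \<open>w\<close> and \<open>h\<close> say that it fits into the square of side 2 around its centroid.
  Unless \<open>w\<close> or \<open>h\<close> is at most \<open>6/5\<close>, enlarging them to their extremal values only strengthens
  the claim.\<close>
lemma corner_ineq:
  fixes w h p q M :: real
  assumes pq: "0 \<le> p" "p \<le> h" "0 \<le> q" "q \<le> w"
    and w: "2 * w \<le> 3 + q" "w + q \<le> 3" and h: "2 * h \<le> 3 + p" "h + p \<le> 3"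
    and M: "w + p \<le> M" "h + q \<le> M" "(w - q) + (h - p) \<le> M"
  shows "5 / 6 * (w * h - p * q) \<le> M"
proof -
  define W where "W = min ((3 + q) / 2) (3 - q)"
  define H where "H = min ((3 + p) / 2) (3 - p)"
  have W: "w \<le> W" and H: "h \<le> H" using w h by (auto simp: W_def H_def)
  consider "h \<le> 6/5" | "w \<le> 6/5" | "6/5 \<le> h" "6/5 \<le> w" by linarith
  then show ?thesis
  proof cases
    case 1
    then show ?thesis using corner_ineq_flat[of p q w M h] pq M by simp
  next
    case 2
    then show ?thesis using corner_ineq_flat[of q p h M w] pq M by (simp add: mult.commute)
  next
    case 3
    \<comment> \<open>Each side length grows by at most \<open>(W - w) + (H - h)\<close> under the
      enlargement. The two increments are then removed one after the other.\<close>
    have "5 / 6 * (W * H - p * q) \<le> M + (W - w) + (H - h)"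
      using pq M W H by (intro corner_ineq_extremal[OF _ _ W_def H_def]) auto
    then have "5 / 6 * (h * W - p * q) \<le> M + (W - w)"
      using corner_ineq_enlarge[of W h H p q "M + (W - w)"] 3 W H by (simp add: mult.commute)
    then show ?thesis
      using corner_ineq_enlarge[of h w W p q M] 3 W by (simp add: mult.commute)
  qed
qed

section \<open>The determinant is bounded by the longest side\<close>

text \<open>Vertex 1 is the lower left corner of the bounding box and vertex 2 lies on its right
  edge. As the vertices sum to 0, the determinant is a third of that of the edge vectors, which
  turns \<open>5/2\<close> into \<open>5/6\<close>.\<close>

lemma abs_det_corner_le:
  fixes x1 x2 x3 y1 y2 y3 M :: real
  assumes "\<bar>x1\<bar> \<le> 1" "\<bar>x2\<bar> \<le> 1" "\<bar>x3\<bar> \<le> 1" "\<bar>y1\<bar> \<le> 1" "\<bar>y2\<bar> \<le> 1" "\<bar>y3\<bar> \<le> 1"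
    and "x1 + x2 + x3 = 0" "y1 + y2 + y3 = 0"
    and "x1 \<le> x2" "x1 \<le> x3" "y1 \<le> y2" "y1 \<le> y3"
    and "\<bar>x2 - x1\<bar> + \<bar>y2 - y1\<bar> \<le> M" "\<bar>x3 - x1\<bar> + \<bar>y3 - y1\<bar> \<le> M" "\<bar>x3 - x2\<bar> + \<bar>y3 - y2\<bar> \<le> M"
    and "x3 \<le> x2"
  shows "5 / 2 * \<bar>x1 * y2 - x2 * y1\<bar> \<le> M"
proof -
  define w q h p where "w = x2 - x1" and "q = x3 - x1" and "h = y3 - y1" and "p = y2 - y1"
  have "3 * x1 = - (w + q)" "3 * y1 = - (h + p)" using assms by (auto simp: w_def q_def h_def p_def)
  then have x: "x1 = - (w + q) / 3" "x2 = w - (w + q) / 3" "y1 = - (h + p) / 3" "y2 = p - (h + p) / 3"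
    by (auto simp: w_def p_def)
  have D: "x1 * y2 - x2 * y1 = (w * h - p * q) / 3"
    unfolding x by (simp add: field_simps)
  have b: "- 1 \<le> x1" "x2 \<le> 1" "- 1 \<le> y1" "y2 \<le> 1" "y3 \<le> 1"
    using assms(1,2,4-6) by (auto simp: abs_le_iff)
  have M: "w + p \<le> M" "q + h \<le> M" "(w - q) + (h - p) \<le> M"
    using assms(13) assms(14) assms(15) abs_ge_self[of "x2 - x1"] abs_ge_self[of "y2 - y1"]
      abs_ge_self[of "x3 - x1"] abs_ge_self[of "y3 - y1"] abs_ge_minus_self[of "x3 - x2"] abs_ge_self[of "y3 - y2"]
    unfolding w_def q_def h_def p_def by argo+
  have qw: "0 \<le> q" "q \<le> w" "0 \<le> p" "0 \<le> h"
    using assms(9-12,16) by (simp_all add: w_def q_def h_def p_def)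
  show ?thesis
  proof (cases "y2 \<le> y3")
    case True
    then have "p * q \<le> h * w" using qw by (intro mult_mono) (auto simp: h_def p_def)
    moreover have "5 / 6 * (w * h - p * q) \<le> M"
      using b M qw True assms(7,8) by (intro corner_ineq) (simp_all add: w_def q_def h_def p_def)
    ultimately show ?thesis unfolding D by (simp add: mult.commute)
  next
    case False
    \<comment> \<open>Vertex 2 is the upper right corner of the box, so the triangle lies in a box
      with sides \<open>w\<close> and \<open>p\<close>, both at most 2. Hence
      \<open>w * p <= w + p <= M\<close>.\<close>
    then have hp: "h \<le> p" by (auto simp: h_def p_def)
    have b2: "w \<le> 2" "p \<le> 2" using b by (simp_all add: w_def p_def)
    have "w * h \<le> w * p" "p * q \<le> p * w" "0 \<le> w * h" "0 \<le> p * q"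
      using hp qw by (auto intro: mult_left_mono)
    then have "\<bar>w * h - p * q\<bar> \<le> w * p" by (simp add: abs_le_iff mult.commute)
    moreover have "w * p \<le> w * 2" "w * p \<le> 2 * p" using b2 qw by (auto intro: mult_left_mono mult_right_mono)
    ultimately show ?thesis using M qw unfolding D by simp
  qed
qed

text \<open>Reflecting the axes by signs \<open>\<sigma>\<close>, \<open>\<tau>\<close> brings
  vertex 1 to the lower left, and exchanging vertices 2 and 3 puts the right one second. Both
  operations change the determinant at most in sign and preserve l1-lengths.\<close>

lemma abs_det_extreme_vertex_le:
  fixes x1 x2 x3 y1 y2 y3 M :: real
  assumes b: "\<bar>x1\<bar> \<le> 1" "\<bar>x2\<bar> \<le> 1" "\<bar>x3\<bar> \<le> 1" "\<bar>y1\<bar> \<le> 1" "\<bar>y2\<bar> \<le> 1" "\<bar>y3\<bar> \<le> 1"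
    and s: "x1 + x2 + x3 = 0" "y1 + y2 + y3 = 0"
    and x: "x1 \<le> x2 \<and> x1 \<le> x3 \<or> x2 \<le> x1 \<and> x3 \<le> x1"
    and y: "y1 \<le> y2 \<and> y1 \<le> y3 \<or> y2 \<le> y1 \<and> y3 \<le> y1"
    and M: "\<bar>x2 - x1\<bar> + \<bar>y2 - y1\<bar> \<le> M" "\<bar>x3 - x1\<bar> + \<bar>y3 - y1\<bar> \<le> M" "\<bar>x3 - x2\<bar> + \<bar>y3 - y2\<bar> \<le> M"
  shows "5 / 2 * \<bar>x1 * y2 - x2 * y1\<bar> \<le> M"
proof -
  have M': "\<bar>x1 - x2\<bar> + \<bar>y1 - y2\<bar> \<le> M" "\<bar>x1 - x3\<bar> + \<bar>y1 - y3\<bar> \<le> M" "\<bar>x2 - x3\<bar> + \<bar>y2 - y3\<bar> \<le> M"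
    using M by (simp_all add: abs_minus_commute)
  have e: "x3 = - x1 - x2" "y3 = - y1 - y2" using s by auto
  have "x1 * y3 - x3 * y1 = x2 * y1 - x1 * y2" unfolding e by (simp add: algebra_simps)
  then have D: "\<bar>x1 * y3 - x3 * y1\<bar> = \<bar>x1 * y2 - x2 * y1\<bar>" by linarith
  have corner: "5 / 2 * \<bar>x1 * y2 - x2 * y1\<bar> \<le> M"
    if "\<sigma> \<in> {-1, 1}" "\<tau> \<in> {-1, 1}" "\<sigma> * x1 \<le> \<sigma> * x3" "\<tau> * y1 \<le> \<tau> * y2" "\<tau> * y1 \<le> \<tau> * y3" "\<sigma> * x3 \<le> \<sigma> * x2"
      "\<bar>x1\<bar> \<le> 1" "\<bar>x2\<bar> \<le> 1" "\<bar>x3\<bar> \<le> 1" "\<bar>y1\<bar> \<le> 1" "\<bar>y2\<bar> \<le> 1" "\<bar>y3\<bar> \<le> 1"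
      "x1 + x2 + x3 = 0" "y1 + y2 + y3 = 0"
      "\<bar>x2 - x1\<bar> + \<bar>y2 - y1\<bar> \<le> M" "\<bar>x3 - x1\<bar> + \<bar>y3 - y1\<bar> \<le> M" "\<bar>x3 - x2\<bar> + \<bar>y3 - y2\<bar> \<le> M"
    for \<sigma> \<tau> x1 x2 x3 y1 y2 y3 :: real
  proof -
    have a: "\<bar>\<sigma> * r\<bar> = \<bar>r\<bar>" "\<bar>\<tau> * r\<bar> = \<bar>r\<bar>" for r :: real using that(1,2) by auto
    have "5 / 2 * \<bar>(\<sigma> * x1) * (\<tau> * y2) - (\<sigma> * x2) * (\<tau> * y1)\<bar> \<le> M"
      using that(3-)
      by (intro abs_det_corner_le[of "\<sigma> * x1" "\<sigma> * x2" "\<sigma> * x3" "\<tau> * y1" "\<tau> * y2" "\<tau> * y3"])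
        (simp_all only: a right_diff_distrib[symmetric] distrib_left[symmetric] mult_zero_right)
    also have "(\<sigma> * x1) * (\<tau> * y2) - (\<sigma> * x2) * (\<tau> * y1) = \<sigma> * (\<tau> * (x1 * y2 - x2 * y1))"
      by (simp add: algebra_simps)
    finally show ?thesis by (simp only: a)
  qed
  obtain \<sigma> :: real where \<sigma>: "\<sigma> \<in> {-1, 1}" "\<sigma> * x1 \<le> \<sigma> * x2" "\<sigma> * x1 \<le> \<sigma> * x3"
  proof -
    from x show ?thesis by (elim disjE) (use that[of 1] that[of "- 1"] in auto)
  qed
  obtain \<tau> :: real where \<tau>: "\<tau> \<in> {-1, 1}" "\<tau> * y1 \<le> \<tau> * y2" "\<tau> * y1 \<le> \<tau> * y3"
  proof -
    from y show ?thesis by (elim disjE) (use that[of 1] that[of "- 1"] in auto)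
  qed
  show ?thesis
  proof (cases "\<sigma> * x3 \<le> \<sigma> * x2")
    case True
    then show ?thesis using \<sigma> \<tau> b s M by (intro corner[of \<sigma> \<tau> x1 x3 y1 y2 y3 x2])
  next
    case False
    then have "\<sigma> * x2 \<le> \<sigma> * x3" by simp
    moreover have "x1 + x3 + x2 = 0" "y1 + y3 + y2 = 0" using s by linarith+
    ultimately have "5 / 2 * \<bar>x1 * y3 - x3 * y1\<bar> \<le> M"
      using \<sigma> \<tau> b M M' by (intro corner[of \<sigma> \<tau> x1 x2 y1 y3 y2 x3])
    then show ?thesis unfolding D .
  qed
qed

text \<open>Of the four extreme coordinate values of the three vertices two occur at the same vertex, so
  some vertex is a corner of the bounding box.\<close>
lemma abs_det_le_max_side:
  fixes x1 x2 x3 y1 y2 y3 M :: real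
  assumes b: "\<bar>x1\<bar> \<le> 1" "\<bar>x2\<bar> \<le> 1" "\<bar>x3\<bar> \<le> 1" "\<bar>y1\<bar> \<le> 1" "\<bar>y2\<bar> \<le> 1" "\<bar>y3\<bar> \<le> 1"
    and s: "x1 + x2 + x3 = 0" "y1 + y2 + y3 = 0"
    and M: "\<bar>x2 - x1\<bar> + \<bar>y2 - y1\<bar> \<le> M" "\<bar>x3 - x1\<bar> + \<bar>y3 - y1\<bar> \<le> M" "\<bar>x3 - x2\<bar> + \<bar>y3 - y2\<bar> \<le> M"
  shows "5 / 2 * \<bar>x1 * y2 - x2 * y1\<bar> \<le> M"
proof -
  have M': "\<bar>x1 - x2\<bar> + \<bar>y1 - y2\<bar> \<le> M" "\<bar>x1 - x3\<bar> + \<bar>y1 - y3\<bar> \<le> M" "\<bar>x2 - x3\<bar> + \<bar>y2 - y3\<bar> \<le> M"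
    using M by (simp_all add: abs_minus_commute)
  have s': "x2 + x3 + x1 = 0" "y2 + y3 + y1 = 0" "x3 + x1 + x2 = 0" "y3 + y1 + y2 = 0"
    using s by linarith+
  have e: "x3 = - x1 - x2" "y3 = - y1 - y2" using s by auto
  have D: "x2 * y3 - x3 * y2 = x1 * y2 - x2 * y1" "x3 * y1 - x1 * y3 = x1 * y2 - x2 * y1"
    unfolding e by (auto simp: algebra_simps)
  define E where "E a b c \<longleftrightarrow> a \<le> b \<and> a \<le> c \<or> b \<le> a \<and> c \<le> a" for a b c :: real
  have two_extreme: "E a b c \<and> E b c a \<or> E a b c \<and> E c a b \<or> E b c a \<and> E c a b" for a b c
    unfolding E_def by (cases "a \<le> b"; cases "b \<le> c"; cases "a \<le> c") auto
  consider "E x1 x2 x3 \<and> E y1 y2 y3" | "E x2 x3 x1 \<and> E y2 y3 y1" | "E x3 x1 x2 \<and> E y3 y1 y2"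
    using two_extreme[of x1 x2 x3] two_extreme[of y1 y2 y3] by blast
  then show ?thesis
  proof cases
    case 1
    then show ?thesis
      unfolding E_def by (intro abs_det_extreme_vertex_le[OF b s _ _ M]) blast+
  next
    case 2
    then have "5 / 2 * \<bar>x2 * y3 - x3 * y2\<bar> \<le> M"
      unfolding E_def
      by (intro abs_det_extreme_vertex_le[OF b(2,3,1,5,6,4) s'(1,2) _ _ M(3) M'(1,2)]) blast+
    then show ?thesis unfolding D .
  next
    case 3
    then have "5 / 2 * \<bar>x3 * y1 - x1 * y3\<bar> \<le> M"
      unfolding E_def
      by (intro abs_det_extreme_vertex_le[OF b(3,1,2,6,4,5) s'(3,4) _ _ M'(2,3) M(1)]) blast+
    then show ?thesis unfolding D .
  qed
qed

section \<open>Covering the corners of the square\<close>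

text \<open>Barycentric form of the corners of the square lying in the triangle scaled by
  \<open>lam\<close> about the origin. Corners suffice, since a linear functional attains its
  minimum on the square at one of them.\<close>

definition covers_corners :: "real \<Rightarrow> real \<Rightarrow> real \<Rightarrow> real \<Rightarrow> real \<Rightarrow> real \<Rightarrow> real \<Rightarrow> bool" where
  "covers_corners lam x1 x2 x3 y1 y2 y3 \<longleftrightarrow> (\<forall>e1\<in>{-1, 1}. \<forall>e2\<in>{-1, 1}. \<exists>t1 t2 t3.
     0 \<le> t1 \<and> 0 \<le> t2 \<and> 0 \<le> t3 \<and> t1 + t2 + t3 = 1 \<and>
     e1 = lam * (t1 * x1 + t2 * x2 + t3 * x3) \<and> e2 = lam * (t1 * y1 + t2 * y2 + t3 * y3))"

lemma covers_corners_rotate: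
  "covers_corners lam x1 x2 x3 y1 y2 y3 \<Longrightarrow> covers_corners lam x2 x3 x1 y2 y3 y1"
  unfolding covers_corners_def
proof (intro ballI)
  fix e1 e2 :: real
  assume "e1 \<in> {-1, 1}" "e2 \<in> {-1, 1}"
    and "\<forall>e1\<in>{-1, 1}. \<forall>e2\<in>{-1, 1}. \<exists>t1 t2 t3.
     0 \<le> t1 \<and> 0 \<le> t2 \<and> 0 \<le> t3 \<and> t1 + t2 + t3 = 1 \<and>
     e1 = lam * (t1 * x1 + t2 * x2 + t3 * x3) \<and> e2 = lam * (t1 * y1 + t2 * y2 + t3 * y3)"
  then obtain t1 t2 t3 where "0 \<le> t1" "0 \<le> t2" "0 \<le> t3" "t1 + t2 + t3 = 1"
    "e1 = lam * (t1 * x1 + t2 * x2 + t3 * x3)" "e2 = lam * (t1 * y1 + t2 * y2 + t3 * y3)"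
    by meson
  then have "0 \<le> t2 \<and> 0 \<le> t3 \<and> 0 \<le> t1 \<and> t2 + t3 + t1 = 1 \<and>
     e1 = lam * (t2 * x2 + t3 * x3 + t1 * x1) \<and> e2 = lam * (t2 * y2 + t3 * y3 + t1 * y1)"
    by (simp only: add_ac)
  then show "\<exists>t1 t2 t3. 0 \<le> t1 \<and> 0 \<le> t2 \<and> 0 \<le> t3 \<and> t1 + t2 + t3 = 1 \<and>
     e1 = lam * (t1 * x2 + t2 * x3 + t3 * x1) \<and> e2 = lam * (t1 * y2 + t2 * y3 + t3 * y1)"
    by blast
qed

text \<open>The linear functional \<open>z \<mapsto> det (v3 - v2, z)\<close> is at least \<open>- D\<close> on the triangle, where
  \<open>D = det (v1, v2)\<close>, and its minimum on the square is minus the l1-norm of \<open>v3 - v2\<close>.\<close>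
lemma covers_corners_side_le:
  fixes lam x1 x2 x3 y1 y2 y3 :: real
  assumes c: "covers_corners lam x1 x2 x3 y1 y2 y3" and "0 \<le> lam"
    and s: "x1 + x2 + x3 = 0" "y1 + y2 + y3 = 0"
  shows "\<bar>x3 - x2\<bar> + \<bar>y3 - y2\<bar> \<le> lam * \<bar>x1 * y2 - x2 * y1\<bar>"
proof -
  define D where "D = x1 * y2 - x2 * y1"
  define n where "n = \<bar>x3 - x2\<bar> + \<bar>y3 - y2\<bar>"
  define sg :: real where "sg = (if 0 \<le> D then 1 else - 1)"
  have sgD: "sg * D = \<bar>D\<bar>" "sg * sg = 1" by (auto simp: sg_def)
  \<comment> \<open>The corner is the one where \<open>sg\<close> times the functional takes its
    minimum \<open>- n\<close> on the square; \<open>sg\<close> accounts for the orientation of the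
    triangle.\<close>
  have "\<exists>e1\<in>{-1, 1}. \<exists>e2\<in>{-1, 1}. (x3 - x2) * e2 - (y3 - y2) * e1 = - sg * n"
    by (cases "0 \<le> x3 - x2"; cases "0 \<le> y3 - y2"; cases "0 \<le> D") (auto simp: sg_def n_def)
  then obtain e1 e2 where "e1 \<in> {-1, 1}" "e2 \<in> {-1, 1}" and n: "(x3 - x2) * e2 - (y3 - y2) * e1 = - sg * n"
    by blast
  then obtain t1 t2 t3 where t: "0 \<le> t1" "0 \<le> t2" "0 \<le> t3" "t1 + t2 + t3 = 1"
    and e: "e1 = lam * (t1 * x1 + t2 * x2 + t3 * x3)" "e2 = lam * (t1 * y1 + t2 * y2 + t3 * y3)"
    using c unfolding covers_corners_def by meson
  have v3: "x3 = - x1 - x2" "y3 = - y1 - y2" "t3 = 1 - t1 - t2" using s t by auto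
  \<comment> \<open>The functional has the values \<open>2 * D\<close>, \<open>- D\<close>,
    \<open>- D\<close> at the three vertices.\<close>
  have "- sg * n = lam * (3 * t1 - 1) * D"
    unfolding n[symmetric] e D_def unfolding v3 by (simp add: algebra_simps)
  then have "sg * (- sg * n) = sg * (lam * (3 * t1 - 1) * D)" by (simp only:)
  then have "(sg * sg) * n = lam * (1 - 3 * t1) * (sg * D)" by (simp add: algebra_simps)
  then have "n = (lam * \<bar>D\<bar>) * (1 - 3 * t1)" unfolding sgD by (simp add: algebra_simps)
  also have "\<dots> \<le> (lam * \<bar>D\<bar>) * 1" using t \<open>0 \<le> lam\<close> by (intro mult_left_mono) auto
  finally show ?thesis unfolding n_def D_def by simp
qed

lemma covers_corners_ratio_ge:
  fixes lam x1 x2 x3 y1 y2 y3 :: real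
  assumes c: "covers_corners lam x1 x2 x3 y1 y2 y3" and lam: "0 \<le> lam"
    and b: "\<bar>x1\<bar> \<le> 1" "\<bar>x2\<bar> \<le> 1" "\<bar>x3\<bar> \<le> 1" "\<bar>y1\<bar> \<le> 1" "\<bar>y2\<bar> \<le> 1" "\<bar>y3\<bar> \<le> 1"
    and s: "x1 + x2 + x3 = 0" "y1 + y2 + y3 = 0"
  shows "5 / 2 \<le> lam"
proof -
  define D where "D = x1 * y2 - x2 * y1"
  have e: "x3 = - x1 - x2" "y3 = - y1 - y2" using s by auto
  have D: "x2 * y3 - x3 * y2 = D" "x3 * y1 - x1 * y3 = D"
    unfolding e D_def by (auto simp: algebra_simps)
  note c2 = covers_corners_rotate[OF c] and c3 = covers_corners_rotate[OF covers_corners_rotate[OF c]]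
  have sides: "\<bar>x3 - x2\<bar> + \<bar>y3 - y2\<bar> \<le> lam * \<bar>D\<bar>" "\<bar>x1 - x3\<bar> + \<bar>y1 - y3\<bar> \<le> lam * \<bar>D\<bar>"
    "\<bar>x2 - x1\<bar> + \<bar>y2 - y1\<bar> \<le> lam * \<bar>D\<bar>"
    using covers_corners_side_le[OF c lam] covers_corners_side_le[OF c2 lam]
      covers_corners_side_le[OF c3 lam] s unfolding D D_def[symmetric] by auto
  \<comment> \<open>Needed to cancel \<open>\<bar>D\<bar>\<close>: if it vanished, all sides would
    have length 0 and all vertices would be the origin, whose multiples miss the corners.\<close>
  have "D \<noteq> 0"
  proof
    assume "D = 0"
    then have "x3 = x2" "x1 = x3" using sides(1,2) by auto
    then have "x1 = 0" "x2 = 0" "x3 = 0" using s by auto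
    then show False using c by (auto simp: covers_corners_def)
  qed
  moreover have "5 / 2 * \<bar>D\<bar> \<le> lam * \<bar>D\<bar>"
    using abs_det_le_max_side[OF b s sides(3) sides(2)[unfolded abs_minus_commute[of x1] abs_minus_commute[of y1]] sides(1)]
    unfolding D_def .
  ultimately show ?thesis by simp
qed

section \<open>Affine maps and centroids\<close>

lemma not_collinear_iff_independent:
  fixes a b c :: "'a::euclidean_space"
  shows "\<not> collinear {a, b, c} \<longleftrightarrow>
    (\<forall>x y. x *\<^sub>R (b - a) + y *\<^sub>R (c - a) = 0 \<longrightarrow> x = 0 \<and> y = 0)"
proof -
  define u v where "u = b - a" and "v = c - a"
  \<comment> \<open>\<open>collinear_3\<close> takes the middle point as origin, so \<open>a\<close>
    is moved there.\<close>
  have "collinear {a, b, c} \<longleftrightarrow> collinear {b, a, c}" by (simp add: insert_commute)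
  also have "\<dots> \<longleftrightarrow> collinear {0, u, v}"
    unfolding u_def v_def by (rule collinear_3) (simp add: NO_MATCH_def)
  also have "\<dots> \<longleftrightarrow> (\<exists>x y. x *\<^sub>R u + y *\<^sub>R v = 0 \<and> \<not> (x = 0 \<and> y = 0))"
  proof
    assume "collinear {0, u, v}"
    then consider "u = 0" | "v = 0" | k where "v = k *\<^sub>R u"
      unfolding collinear_lemma by blast
    then show "\<exists>x y. x *\<^sub>R u + y *\<^sub>R v = 0 \<and> \<not> (x = 0 \<and> y = 0)"
    proof cases
      case 1
      then show ?thesis by (intro exI[of _ 1] exI[of _ 0]) simp
    next
      case 2
      then show ?thesis by (intro exI[of _ 0] exI[of _ 1]) simp
    next
      case 3
      then show ?thesis by (intro exI[of _ "- k"] exI[of _ 1]) simp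
    qed
  next
    assume "\<exists>x y. x *\<^sub>R u + y *\<^sub>R v = 0 \<and> \<not> (x = 0 \<and> y = 0)"
    then obtain x y where xy: "x *\<^sub>R u + y *\<^sub>R v = 0" "\<not> (x = 0 \<and> y = 0)" by blast
    show "collinear {0, u, v}"
    proof (cases "y = 0")
      case True
      then show ?thesis using xy by simp
    next
      case False
      have "y *\<^sub>R v = y *\<^sub>R ((- x / y) *\<^sub>R u)" using xy False by (simp add: add_eq_0_iff2)
      then have "v = (- x / y) *\<^sub>R u" using False by (simp only: scaleR_cancel_left simp_thms)
      then show ?thesis unfolding collinear_lemma by blast
    qed
  qed
  finally show ?thesis unfolding u_def v_def by blast
qed

lemma nondeg_affine_image_convex_hull:
  assumes "nondeg_affine a"
  shows "a ` (convex hull S) = convex hull (a ` S)"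
proof -
  obtain f b where f: "linear f" and a: "a = (\<lambda>x. f x + b)"
    using assms unfolding nondeg_affine_def by blast
  have a': "a ` X = (\<lambda>x. b + x) ` f ` X" for X unfolding a by (auto simp: image_image add.commute)
  show ?thesis
    unfolding a' convex_hull_linear_image[OF f] convex_hull_translation ..
qed

lemma nondeg_affine_lincomb:
  assumes "nondeg_affine a"
  shows "a (p + x *\<^sub>R (q - p) + y *\<^sub>R (r - p)) = a p + x *\<^sub>R (a q - a p) + y *\<^sub>R (a r - a p)"
proof -
  obtain f b where f: "linear f" and a: "a = (\<lambda>x. f x + b)"
    using assms unfolding nondeg_affine_def by blast
  show ?thesis unfolding a by (simp add: linear_add[OF f] linear_diff[OF f] linear_scale[OF f])
qed

lemma nondeg_affine_not_collinear:
  assumes "nondeg_affine a" "\<not> collinear {p, q, r}"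
  shows "\<not> collinear {a p, a q, a r}"
proof -
  obtain f b where f: "linear f" "inj f" and a: "a = (\<lambda>x. f x + b)"
    using assms unfolding nondeg_affine_def by blast
  have e: "x *\<^sub>R (a q - a p) + y *\<^sub>R (a r - a p) = f (x *\<^sub>R (q - p) + y *\<^sub>R (r - p))" for x y
    unfolding a by (simp add: linear_add[OF f(1)] linear_diff[OF f(1)] linear_scale[OF f(1)])
  have "f z = 0 \<longleftrightarrow> z = 0" for z using f(2) linear_0[OF f(1)] by (metis injD)
  then show ?thesis
    using assms(2) unfolding not_collinear_iff_independent e by simp
qed

lemma not_collinear_frame:
  fixes p q r :: "real^2"
  assumes nc: "\<not> collinear {p, q, r}"
  shows "linear (\<lambda>z::real^2. z$1 *\<^sub>R (q - p) + z$2 *\<^sub>R (r - p))" (is "linear ?F")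
    and "inj (\<lambda>z::real^2. z$1 *\<^sub>R (q - p) + z$2 *\<^sub>R (r - p))"
proof -
  show lin: "linear ?F"
    by (rule linearI) (simp_all add: scaleR_add_left scaleR_add_right)
  have "z = 0" if "?F z = 0" for z
  proof -
    have "z$1 = 0 \<and> z$2 = 0" using that nc unfolding not_collinear_iff_independent by blast
    then show ?thesis by (simp add: vec_eq_iff forall_2)
  qed
  then show "inj ?F" using linear_injective_0[OF lin] by blast
qed

lemma not_collinear_coordinates:
  fixes p q r z :: "real^2"
  assumes nc: "\<not> collinear {p, q, r}"
  obtains x y where "z = p + x *\<^sub>R (q - p) + y *\<^sub>R (r - p)"
proof -
  have "surj (\<lambda>z::real^2. z$1 *\<^sub>R (q - p) + z$2 *\<^sub>R (r - p))"
    by (rule linear_injective_imp_surjective[OF not_collinear_frame[OF nc] refl])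
  from surjD[OF this, of "z - p"]
  obtain w :: "real^2" where "z - p = w$1 *\<^sub>R (q - p) + w$2 *\<^sub>R (r - p)" by blast
  then have "z = p + w$1 *\<^sub>R (q - p) + w$2 *\<^sub>R (r - p)" by (simp add: algebra_simps)
  then show ?thesis by (rule that)
qed

text \<open>Undo the frame of the first triangle, apply that of the second, then translate. This
  supplies the symmetries of a triangle and the map onto the optimal triangle.\<close>

lemma nondeg_affine_exists:
  fixes p q r p' q' r' :: "real^2"
  assumes nc: "\<not> collinear {p, q, r}" and nc': "\<not> collinear {p', q', r'}"
  obtains a where "nondeg_affine a" "a p = p'" "a q = q'" "a r = r'"
proof -
  define F :: "real^2 \<Rightarrow> real^2 \<Rightarrow> real^2 \<Rightarrow> real^2" where "F u v z = z$1 *\<^sub>R u + z$2 *\<^sub>R v" for u v z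
  note frame = not_collinear_frame[folded F_def]
  obtain g where g: "linear g" "g \<circ> F (q - p) (r - p) = id"
    using linear_injective_left_inverse[OF frame[OF nc]] by blast
  then have "surj g" by (metis comp_apply id_apply surjI)
  then have "inj g" using g(1) linear_surjective_imp_injective by blast
  define h where "h = F (q' - p') (r' - p') \<circ> g"
  have h: "linear h" "inj h"
    unfolding h_def using frame[OF nc'] g(1) \<open>inj g\<close> by (auto intro: linear_compose inj_compose)
  have hF: "h (F (q - p) (r - p) z) = F (q' - p') (r' - p') z" for z
    unfolding h_def using g(2) by (simp add: fun_eq_iff)
  have "h (q - p) = q' - p'" using hF[of "vector [1, 0]"] by (simp add: F_def)
  moreover have "h (r - p) = r' - p'" using hF[of "vector [0, 1]"] by (simp add: F_def)
  ultimately have "h q - h p = q' - p'" "h r - h p = r' - p'"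
    by (simp_all add: linear_diff[OF h(1)])
  then have "h p + (p' - h p) = p'" "h q + (p' - h p) = q'" "h r + (p' - h p) = r'"
    by (simp_all add: algebra_simps)
  moreover have "nondeg_affine (\<lambda>x. h x + (p' - h p))"
    unfolding nondeg_affine_def using h by blast
  ultimately show ?thesis using that by blast
qed

section \<open>Centroids of affine images, triangles and parallelograms\<close>

text \<open>By change of variables the integral and the area both acquire the constant factor
  \<open>\<bar>det (matrix f)\<bar>\<close>, which cancels. The nonempty interior makes the area
  nonzero.\<close>

lemma cen_nondeg_affine_image:
  assumes S: "compact S" "convex S" "interior S \<noteq> {}" and "nondeg_affine a"
  shows "cen (a ` S) = a (cen S)"
proof -
  obtain f b where f: "linear f" "inj f" and a: "a = (\<lambda>x. f x + b)"
    using assms unfolding nondeg_affine_def by blast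
  interpret f: bounded_linear f using f(1) linear_conv_bounded_linear by blast
  define d where "d = \<bar>det (matrix f)\<bar>"
  have "d \<noteq> 0" unfolding d_def using f det_nz_iff_inj by auto
  have meas: "S \<in> lmeasurable" using S(1) by (rule lmeasurable_compact)
  then have m: "measure lebesgue S \<noteq> 0"
    using S negligible_convex_interior negligible_iff_measure by blast
  have abs_int: "g absolutely_integrable_on S" if "continuous_on S g" for g :: "real^2 \<Rightarrow> real^2"
    using borel_integrable_compact[OF S(1) that] S(1) unfolding set_integrable_def
    by (intro integrable_completion[THEN iffD2]) auto
  have "a ` S = (+) b ` f ` S" unfolding a by (auto simp: image_image add.commute)
  then have ma: "measure lebesgue (a ` S) = d * measure lebesgue S"
    unfolding d_def using measure_linear_image[OF f(1) meas] measure_translation by metis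
  have const: "integral S (\<lambda>x. b) = measure lebesgue S *\<^sub>R b"
    using integral_linear[OF integrable_on_const[OF meas, of "1::real"] bounded_linear_scaleR_left[of b]]
      lmeasure_integral[OF meas] by (simp add: o_def)
  have "(\<lambda>x. x) integrable_on S"
    using abs_int[of "\<lambda>x. x"] set_lebesgue_integral_eq_integral(1) by auto
  then have lin: "integral S f = f (integral S (\<lambda>x. x))" "f integrable_on S"
    using integral_linear[OF _ f.bounded_linear_axioms] integrable_linear[OF _ f.bounded_linear_axioms]
    by (auto simp: o_def)
  have "(\<lambda>x. d *\<^sub>R a x) absolutely_integrable_on S"
    unfolding a by (intro abs_int continuous_intros f.continuous_on)
  moreover have "inj_on a S" unfolding a using f(2) by (auto simp: inj_on_def)
  moreover have "(a has_derivative f) (at x within S)" for x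
    unfolding a by (auto intro!: derivative_eq_intros f.has_derivative)
  ultimately have "integral (a ` S) (\<lambda>x. x) = integral S (\<lambda>x. d *\<^sub>R a x)"
    using has_absolute_integral_change_of_variables[of S a "\<lambda>_. f" "\<lambda>x. x"] meas
    unfolding d_def by auto
  also have "\<dots> = d *\<^sub>R (f (integral S (\<lambda>x. x)) + measure lebesgue S *\<^sub>R b)"
    unfolding a using lin const integral_add[OF lin(2) integrable_on_const[OF meas, of b]] by simp
  finally show ?thesis
    unfolding cen_def ma using m \<open>d \<noteq> 0\<close> by (simp add: a f.scaleR scaleR_add_right)
qed

lemma triangle_interior_nonempty:
  fixes p q r :: "real^2"
  assumes "\<not> collinear {p, q, r}"
  shows "interior (convex hull {p, q, r}) \<noteq> {}"
proof -
  have "(1/3) *\<^sub>R p + (1/3) *\<^sub>R q + (1/3) *\<^sub>R r \<in> interior (convex hull {p, q, r})"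
    using assms by (subst interior_convex_hull_3_minimal) (auto intro!: exI[of _ "1/3"])
  then show ?thesis by blast
qed

text \<open>Affine maps that permute the vertices fix the centroid. Two transpositions force its
  coordinates in the frame at \<open>p\<close> to satisfy \<open>x = y\<close> and
  \<open>2 * x + y = 1\<close>.\<close>

lemma cen_triangle:
  fixes p q r :: "real^2"
  assumes nc: "\<not> collinear {p, q, r}"
  shows "cen (convex hull {p, q, r}) = (1/3) *\<^sub>R (p + q + r)"
proof -
  define T where "T = convex hull {p, q, r}"
  have T: "compact T" "convex T" "interior T \<noteq> {}"
    unfolding T_def using triangle_interior_nonempty[OF nc]
    by (auto intro!: finite_imp_compact_convex_hull)
  have fixed: "a (cen T) = cen T" if "nondeg_affine a" "a ` {p, q, r} = {p, q, r}" for a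
    using cen_nondeg_affine_image[OF T that(1)] that
    unfolding T_def nondeg_affine_image_convex_hull[OF that(1)] by simp
  obtain x y where c: "cen T = p + x *\<^sub>R (q - p) + y *\<^sub>R (r - p)"
    using not_collinear_coordinates[OF nc] by blast
  have indep: "s = 0 \<and> t = 0" if "s *\<^sub>R (q - p) + t *\<^sub>R (r - p) = 0" for s t
    using nc that unfolding not_collinear_iff_independent by blast
  have "y - x = 0 \<and> x - y = 0"
  proof -
    obtain a where a: "nondeg_affine a" "a p = p" "a q = r" "a r = q"
      using nondeg_affine_exists[of p q r p r q] nc by (auto simp: insert_commute)
    then have "p + x *\<^sub>R (r - p) + y *\<^sub>R (q - p) = p + x *\<^sub>R (q - p) + y *\<^sub>R (r - p)"
      using nondeg_affine_lincomb[OF a(1), of p x q y r] fixed[OF a(1)] unfolding c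
      by (auto simp: insert_commute)
    then show ?thesis by (intro indep) (simp add: algebra_simps)
  qed
  \<comment> \<open>The transposition of \<open>p\<close> and \<open>q\<close>, with both sides
    expressed in the frame at \<open>p\<close>; \<open>y - y\<close> gives the equation the shape
    that \<open>indep\<close> expects.\<close>
  moreover have "1 - x - y - x = 0 \<and> y - y = 0"
  proof -
    obtain a where a: "nondeg_affine a" "a p = q" "a q = p" "a r = r"
      using nondeg_affine_exists[of p q r q p r] nc by (auto simp: insert_commute)
    then have "q + x *\<^sub>R (p - q) + y *\<^sub>R (r - q) = p + x *\<^sub>R (q - p) + y *\<^sub>R (r - p)"
      using nondeg_affine_lincomb[OF a(1), of p x q y r] fixed[OF a(1)] unfolding c
      by (auto simp: insert_commute)
    then have "(q + x *\<^sub>R (p - q) + y *\<^sub>R (r - q)) - (p + x *\<^sub>R (q - p) + y *\<^sub>R (r - p)) = 0"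
      by (simp only: diff_self)
    also have "(q + x *\<^sub>R (p - q) + y *\<^sub>R (r - q)) - (p + x *\<^sub>R (q - p) + y *\<^sub>R (r - p))
      = (1 - x - y - x) *\<^sub>R (q - p) + (y - y) *\<^sub>R (r - p)"
      by (simp add: vec_eq_iff algebra_simps)
    finally show ?thesis by (rule indep)
  qed
  ultimately have "x = 1/3" "y = 1/3" by argo+
  moreover have "p + (1/3) *\<^sub>R (q - p) + (1/3) *\<^sub>R (r - p) = (1/3) *\<^sub>R (p + q + r)"
    by (simp add: vec_eq_iff field_simps)
  ultimately show ?thesis using c unfolding T_def by (simp only:)
qed

text \<open>Taking the centre as origin and half the edges as basis turns the parallelogram into the
  square \<open>[-1,1]\<close> times \<open>[-1,1]\<close>. \<open>QI\<close> and \<open>QE\<close>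
  translate to and from coordinates in \<open>[0,1]\<close> based at the vertex
  \<open>p\<close>.\<close>

lemma parallelogram_eq:
  assumes "parallelogram P"
  obtains c u v where "P = {c + x *\<^sub>R u + y *\<^sub>R v | x y. \<bar>x\<bar> \<le> 1 \<and> \<bar>y\<bar> \<le> 1}"
    and "\<forall>x y. x *\<^sub>R u + y *\<^sub>R v = 0 \<longrightarrow> x = 0 \<and> y = 0"
proof -
  obtain p u v where nc: "\<not> collinear {p, p + u, p + v}"
    and P: "P = convex hull {p, p + u, p + v, p + u + v}"
    using assms unfolding parallelogram_def by blast
  define Q where "Q = {p + (1/2) *\<^sub>R (u + v) + x *\<^sub>R ((1/2) *\<^sub>R u) + y *\<^sub>R ((1/2) *\<^sub>R v) | x y. \<bar>x\<bar> \<le> 1 \<and> \<bar>y\<bar> \<le> 1}"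
  have QI: "z \<in> Q" if "z = p + s *\<^sub>R u + t *\<^sub>R v" "0 \<le> s" "s \<le> 1" "0 \<le> t" "t \<le> 1" for z s t
  proof -
    have "z = p + (1/2) *\<^sub>R (u + v) + (2 * s - 1) *\<^sub>R ((1/2) *\<^sub>R u) + (2 * t - 1) *\<^sub>R ((1/2) *\<^sub>R v)"
      unfolding that(1) by (simp add: vec_eq_iff field_simps)
    moreover have "\<bar>2 * s - 1\<bar> \<le> 1" "\<bar>2 * t - 1\<bar> \<le> 1" using that by auto
    ultimately show ?thesis unfolding Q_def by blast
  qed
  have QE: "\<exists>s t. z = p + s *\<^sub>R u + t *\<^sub>R v \<and> 0 \<le> s \<and> s \<le> 1 \<and> 0 \<le> t \<and> t \<le> 1" if "z \<in> Q" for z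
  proof -
    obtain x y where "z = p + (1/2) *\<^sub>R (u + v) + x *\<^sub>R ((1/2) *\<^sub>R u) + y *\<^sub>R ((1/2) *\<^sub>R v)"
      and xy: "\<bar>x\<bar> \<le> 1" "\<bar>y\<bar> \<le> 1"
      using \<open>z \<in> Q\<close> unfolding Q_def by blast
    then have "z = p + ((1 + x) / 2) *\<^sub>R u + ((1 + y) / 2) *\<^sub>R v"
      by (simp add: algebra_simps add_divide_distrib)
    then show ?thesis using xy by (intro exI[of _ "(1 + x) / 2"] exI[of _ "(1 + y) / 2"]) auto
  qed
  have "P \<subseteq> Q" unfolding P
  proof (rule hull_minimal)
    show "{p, p + u, p + v, p + u + v} \<subseteq> Q"
      using QI[of p 0 0] QI[of "p + u" 1 0] QI[of "p + v" 0 1] QI[of "p + u + v" 1 1] by simp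
    show "convex Q"
    proof (rule convexI)
      fix z w and a b :: real
      assume ab: "0 \<le> a" "0 \<le> b" "a + b = 1" and "z \<in> Q" "w \<in> Q"
      then obtain s t s' t' where z: "z = p + s *\<^sub>R u + t *\<^sub>R v" "0 \<le> s" "s \<le> 1" "0 \<le> t" "t \<le> 1"
        and w: "w = p + s' *\<^sub>R u + t' *\<^sub>R v" "0 \<le> s'" "s' \<le> 1" "0 \<le> t'" "t' \<le> 1"
        using QE by meson
      have "a *\<^sub>R z + b *\<^sub>R w = (a + b) *\<^sub>R p + (a * s + b * s') *\<^sub>R u + (a * t + b * t') *\<^sub>R v"
        unfolding z w by (simp add: algebra_simps)
      then have "a *\<^sub>R z + b *\<^sub>R w = p + (a * s + b * s') *\<^sub>R u + (a * t + b * t') *\<^sub>R v"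
        unfolding ab(3) by simp
      moreover have "a * s + b * s' \<le> 1" "a * t + b * t' \<le> 1"
        using ab z w by (auto intro!: convex_bound_le)
      ultimately show "a *\<^sub>R z + b *\<^sub>R w \<in> Q" using ab z w
        by (intro QI[of _ "a * s + b * s'" "a * t + b * t'"]) auto
    qed
  qed
  moreover have "Q \<subseteq> P"
  proof
    fix z assume "z \<in> Q"
    then obtain s t where z: "z = p + s *\<^sub>R u + t *\<^sub>R v" and st: "0 \<le> s" "s \<le> 1" "0 \<le> t" "t \<le> 1"
      using QE by meson
    have conv: "convex P" unfolding P by simp
    have vert: "p \<in> P" "p + u \<in> P" "p + v \<in> P" "p + u + v \<in> P" unfolding P by (auto intro: hull_inc)
    \<comment> \<open>Bilinear interpolation: first along two opposite edges, then between the
      points found.\<close>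
    have "(1 - t) *\<^sub>R ((1 - s) *\<^sub>R p + s *\<^sub>R (p + u)) + t *\<^sub>R ((1 - s) *\<^sub>R (p + v) + s *\<^sub>R (p + u + v)) \<in> P"
      using st vert by (intro convexD[OF conv]) auto
    then show "z \<in> P" unfolding z by (simp add: algebra_simps)
  qed
  ultimately have "P = Q" by blast
  moreover have "x = 0 \<and> y = 0" if "x *\<^sub>R ((1/2) *\<^sub>R u) + y *\<^sub>R ((1/2) *\<^sub>R v) = 0" for x y
  proof -
    have "(x / 2) *\<^sub>R (p + u - p) + (y / 2) *\<^sub>R (p + v - p) = 0" using that by simp
    then have "x / 2 = 0 \<and> y / 2 = 0" using nc unfolding not_collinear_iff_independent by blast
    then show ?thesis by simp
  qed
  ultimately show ?thesis unfolding Q_def by (intro that) blast+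
qed

text \<open>The point reflection in \<open>c\<close> maps \<open>P\<close> onto itself, so it fixes
  the centroid, and \<open>c\<close> is its only fixed point.\<close>

lemma cen_parallelogram:
  assumes "parallelogram P" and P: "P = {c + x *\<^sub>R u + y *\<^sub>R v | x y. \<bar>x\<bar> \<le> 1 \<and> \<bar>y\<bar> \<le> 1}"
  shows "cen P = c"
proof -
  obtain p u' v' where nc: "\<not> collinear {p, p + u', p + v'}"
    and P': "P = convex hull {p, p + u', p + v', p + u' + v'}"
    using assms unfolding parallelogram_def by blast
  have "convex hull {p, p + u', p + v'} \<subseteq> P" unfolding P' by (intro hull_mono) auto
  then have int: "interior P \<noteq> {}"
    using triangle_interior_nonempty[OF nc] interior_mono by blast
  have refl: "nondeg_affine (\<lambda>z. - z + 2 *\<^sub>R c)"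
    unfolding nondeg_affine_def by (intro exI[of _ uminus] exI[of _ "2 *\<^sub>R c"]) (auto simp: linear_uminus)
  have sub: "(\<lambda>z. - z + 2 *\<^sub>R c) ` P \<subseteq> P"
  proof
    fix w assume "w \<in> (\<lambda>z. - z + 2 *\<^sub>R c) ` P"
    then obtain x y where "\<bar>x\<bar> \<le> 1" "\<bar>y\<bar> \<le> 1" "w = - (c + x *\<^sub>R u + y *\<^sub>R v) + 2 *\<^sub>R c"
      unfolding P by blast
    then have "w = c + (- x) *\<^sub>R u + (- y) *\<^sub>R v" "\<bar>- x\<bar> \<le> 1" "\<bar>- y\<bar> \<le> 1"
      by (simp_all add: scaleR_2)
    then show "w \<in> P" unfolding P by blast
  qed
  \<comment> \<open>The reflection is an involution, so applying it to the inclusion yields the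
    reverse one.\<close>
  then have "(\<lambda>z. - z + 2 *\<^sub>R c) ` (\<lambda>z. - z + 2 *\<^sub>R c) ` P \<subseteq> (\<lambda>z. - z + 2 *\<^sub>R c) ` P"
    by (rule image_mono)
  then have "(\<lambda>z. - z + 2 *\<^sub>R c) ` P = P" using sub by (simp add: image_image)
  then have "cen P = - cen P + 2 *\<^sub>R c"
    using cen_nondeg_affine_image[OF _ _ int refl] unfolding P'
    by (simp add: finite_imp_compact_convex_hull)
  then show ?thesis by (simp add: vec_eq_iff)
qed

section \<open>The extremal ratio\<close>

text \<open>In the coordinates given by \<open>c\<close>, \<open>u\<close>, \<open>v\<close> the
  parallelogram is the square and the homothety is multiplication by \<open>lam\<close>, so the
  bound for covered corners applies.\<close>

lemma homothety_ratio_ge: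
  fixes P :: "(real^2) set"
  assumes P: "P = {c + x *\<^sub>R u + y *\<^sub>R v | x y. \<bar>x\<bar> \<le> 1 \<and> \<bar>y\<bar> \<le> 1}"
    and indep: "\<And>x y. x *\<^sub>R u + y *\<^sub>R v = 0 \<Longrightarrow> x = 0 \<and> y = 0"
    and sub: "convex hull {v1, v2, v3} \<subseteq> P"
    and cen: "(1/3) *\<^sub>R (v1 + v2 + v3) = c"
    and sup: "P \<subseteq> homothety c lam ` (convex hull {v1, v2, v3})" and "0 \<le> lam"
  shows "5 / 2 \<le> lam"
proof -
  have coord: "\<exists>x y. w = c + x *\<^sub>R u + y *\<^sub>R v \<and> \<bar>x\<bar> \<le> 1 \<and> \<bar>y\<bar> \<le> 1" if "w \<in> {v1, v2, v3}" for w
    using hull_inc[OF that] sub unfolding P by blast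
  obtain x1 y1 where v1: "v1 = c + x1 *\<^sub>R u + y1 *\<^sub>R v" and b1: "\<bar>x1\<bar> \<le> 1" "\<bar>y1\<bar> \<le> 1"
    using coord[of v1] by blast
  obtain x2 y2 where v2: "v2 = c + x2 *\<^sub>R u + y2 *\<^sub>R v" and b2: "\<bar>x2\<bar> \<le> 1" "\<bar>y2\<bar> \<le> 1"
    using coord[of v2] by blast
  obtain x3 y3 where v3: "v3 = c + x3 *\<^sub>R u + y3 *\<^sub>R v" and b3: "\<bar>x3\<bar> \<le> 1" "\<bar>y3\<bar> \<le> 1"
    using coord[of v3] by blast
  have "3 *\<^sub>R c = v1 + v2 + v3" using cen by auto
  also have "\<dots> = 3 *\<^sub>R c + ((x1 + x2 + x3) *\<^sub>R u + (y1 + y2 + y3) *\<^sub>R v)"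
    unfolding v1 v2 v3 by (simp add: vec_eq_iff algebra_simps)
  finally have s: "x1 + x2 + x3 = 0" "y1 + y2 + y3 = 0" using indep by simp_all
  have "covers_corners lam x1 x2 x3 y1 y2 y3"
    unfolding covers_corners_def
  proof (intro ballI)
    fix e1 e2 :: real
    assume "e1 \<in> {-1, 1}" "e2 \<in> {-1, 1}"
    then have "c + e1 *\<^sub>R u + e2 *\<^sub>R v \<in> P" unfolding P by force
    then obtain w where w: "w \<in> convex hull {v1, v2, v3}" "c + e1 *\<^sub>R u + e2 *\<^sub>R v = homothety c lam w"
      using sup by blast
    then obtain t1 t2 t3 where t: "0 \<le> t1" "0 \<le> t2" "0 \<le> t3" "t1 + t2 + t3 = 1"
      and w': "w = t1 *\<^sub>R v1 + t2 *\<^sub>R v2 + t3 *\<^sub>R v3"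
      unfolding convex_hull_3 by blast
    define X Y where "X = t1 * x1 + t2 * x2 + t3 * x3" and "Y = t1 * y1 + t2 * y2 + t3 * y3"
    have "w = (t1 + t2 + t3) *\<^sub>R c + X *\<^sub>R u + Y *\<^sub>R v"
      unfolding w' v1 v2 v3 X_def Y_def by (simp add: algebra_simps)
    then have "(e1 - lam * X) *\<^sub>R u + (e2 - lam * Y) *\<^sub>R v = 0"
      using w(2) unfolding homothety_def t(4) by (simp add: algebra_simps)
    from indep[OF this] have "e1 = lam * X" "e2 = lam * Y" by auto
    then show "\<exists>t1 t2 t3. 0 \<le> t1 \<and> 0 \<le> t2 \<and> 0 \<le> t3 \<and> t1 + t2 + t3 = 1 \<and>
        e1 = lam * (t1 * x1 + t2 * x2 + t3 * x3) \<and> e2 = lam * (t1 * y1 + t2 * y2 + t3 * y3)"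
      using t unfolding X_def Y_def by blast
  qed
  then show ?thesis using covers_corners_ratio_ge[OF _ \<open>0 \<le> lam\<close> b1(1) b2(1) b3(1) b1(2) b2(2) b3(2) s] by blast
qed

lemma homothety_ratio_attained:
  fixes P :: "(real^2) set"
  assumes P: "P = {c + x *\<^sub>R u + y *\<^sub>R v | x y. \<bar>x\<bar> \<le> 1 \<and> \<bar>y\<bar> \<le> 1}" and "convex P"
    and indep: "\<And>x y. x *\<^sub>R u + y *\<^sub>R v = 0 \<Longrightarrow> x = 0 \<and> y = 0"
  obtains v1 v2 v3 where "\<not> collinear {v1, v2, v3}" "convex hull {v1, v2, v3} \<subseteq> P"
    "(1/3) *\<^sub>R (v1 + v2 + v3) = c" "P \<subseteq> homothety c (5/2) ` (convex hull {v1, v2, v3})"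
proof -
  define v1 v2 v3 where "v1 = c + (-1) *\<^sub>R u + (-1/2) *\<^sub>R v" and "v2 = c + 1 *\<^sub>R u + (-1/2) *\<^sub>R v"
    and "v3 = c + 0 *\<^sub>R u + 1 *\<^sub>R v"
  note vs = v1_def v2_def v3_def
  have "\<not> collinear {v1, v2, v3}"
    unfolding not_collinear_iff_independent
  proof (intro allI impI)
    fix x y assume "x *\<^sub>R (v2 - v1) + y *\<^sub>R (v3 - v1) = 0"
    then have "(2 * x + y) *\<^sub>R u + (3/2 * y) *\<^sub>R v = 0" unfolding vs by (simp add: vec_eq_iff field_simps)
    then have "2 * x + y = 0 \<and> 3/2 * y = 0" by (rule indep)
    then show "x = 0 \<and> y = 0" by simp
  qed
  moreover have "v1 \<in> P" unfolding P v1_def by (rule CollectI, rule exI[of _ "-1"], rule exI[of _ "-1/2"]) simp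
  moreover have "v2 \<in> P" unfolding P v2_def by (rule CollectI, rule exI[of _ "1"], rule exI[of _ "-1/2"]) simp
  moreover have "v3 \<in> P" unfolding P v3_def by (rule CollectI, rule exI[of _ "0"], rule exI[of _ "1"]) simp
  moreover have "(1/3) *\<^sub>R (v1 + v2 + v3) = c" unfolding vs by (simp add: vec_eq_iff field_simps)
  moreover have "P \<subseteq> homothety c (5/2) ` (convex hull {v1, v2, v3})"
  proof
    fix z assume "z \<in> P"
    then obtain x y where z: "z = c + x *\<^sub>R u + y *\<^sub>R v" and xy: "\<bar>x\<bar> \<le> 1" "\<bar>y\<bar> \<le> 1" unfolding P by blast
    \<comment> \<open>Barycentric coordinates of the preimage \<open>(2/5 * x, 2/5 * y)\<close>.
      \<open>t1\<close> vanishes at the corner \<open>(1, 1)\<close> and \<open>t2\<close> at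
      \<open>(-1, 1)\<close>, so this triangle admits no smaller ratio.\<close>
    define t1 t2 t3 where "t1 = (1 - 2 * y / 5) / 3 - x / 5" and "t2 = (1 - 2 * y / 5) / 3 + x / 5"
      and "t3 = (1 + 4 * y / 5) / 3"
    note ts = t1_def t2_def t3_def
    have t: "0 \<le> t1" "0 \<le> t2" "0 \<le> t3" "t1 + t2 + t3 = 1" unfolding ts using xy by argo+
    have x: "5 / 2 * (t2 - t1) = x" and y: "5 / 2 * (t3 - (t1 + t2) / 2) = y" unfolding ts by argo+
    define w where "w = t1 *\<^sub>R v1 + t2 *\<^sub>R v2 + t3 *\<^sub>R v3"
    have "w \<in> convex hull {v1, v2, v3}" unfolding convex_hull_3 w_def using t by blast
    moreover have "w = (t1 + t2 + t3) *\<^sub>R c + (t2 - t1) *\<^sub>R u + (t3 - (t1 + t2) / 2) *\<^sub>R v"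
      unfolding w_def vs by (simp add: algebra_simps add_divide_distrib)
    then have "homothety c (5/2) w = c + (5/2) *\<^sub>R ((t2 - t1) *\<^sub>R u + (t3 - (t1 + t2) / 2) *\<^sub>R v)"
      unfolding homothety_def t(4) by simp
    then have "z = homothety c (5/2) w"
      by (simp only: scaleR_add_right scaleR_scaleR x y z add.assoc)
    ultimately show "z \<in> homothety c (5/2) ` (convex hull {v1, v2, v3})" by blast
  qed
  ultimately show ?thesis using \<open>convex P\<close> by (intro that[of v1 v2 v3] hull_minimal) auto
qed

theorem mainTheorem1:
  fixes P T :: "(real^2) set"
  assumes "parallelogram P" and "triangle T"
  shows "cen_BM P T = 5 / 2"
proof -
  obtain c u v where P: "P = {c + x *\<^sub>R u + y *\<^sub>R v | x y. \<bar>x\<bar> \<le> 1 \<and> \<bar>y\<bar> \<le> 1}"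
    and "\<forall>x y. x *\<^sub>R u + y *\<^sub>R v = 0 \<longrightarrow> x = 0 \<and> y = 0"
    by (rule parallelogram_eq[OF assms(1)])
  then have indep: "x = 0 \<and> y = 0" if "x *\<^sub>R u + y *\<^sub>R v = 0" for x y using that by blast
  have cenP: "cen P = c" using cen_parallelogram[OF assms(1) P] .
  have "convex P" using assms(1) unfolding parallelogram_def by (auto simp: convex_convex_hull)
  obtain p q r where nc: "\<not> collinear {p, q, r}" and T: "T = convex hull {p, q, r}"
    using assms(2) unfolding triangle_def by blast
  have aT: "a ` T = convex hull {a p, a q, a r}" "cen (a ` T) = (1/3) *\<^sub>R (a p + a q + a r)"
    if "nondeg_affine a" for a
    using nondeg_affine_image_convex_hull[OF that] cen_triangle[OF nondeg_affine_not_collinear[OF that nc]]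
    unfolding T by simp_all
  show ?thesis
    unfolding cen_BM_def
  \<comment> \<open>The infimum is attained: an affine map carries \<open>T\<close> onto the optimal
    triangle, and every admissible ratio is at least \<open>5/2\<close>.\<close>
  proof (rule cInf_eq_minimum)
    obtain v1 v2 v3 where w: "\<not> collinear {v1, v2, v3}" "convex hull {v1, v2, v3} \<subseteq> P"
      "(1/3) *\<^sub>R (v1 + v2 + v3) = c" "P \<subseteq> homothety c (5/2) ` (convex hull {v1, v2, v3})"
      using homothety_ratio_attained[OF P \<open>convex P\<close> indep] by blast
    obtain a where a: "nondeg_affine a" "a p = v1" "a q = v2" "a r = v3"
      using nondeg_affine_exists[OF nc w(1)] by blast
    have "a ` T = convex hull {v1, v2, v3}" "cen (a ` T) = c" using aT[OF a(1)] a w(3) by simp_all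
    then show "5 / 2 \<in> {lam. lam \<ge> 1 \<and> (\<exists>a. nondeg_affine a \<and> a ` T \<subseteq> P
       \<and> P \<subseteq> homothety (cen (a ` T)) lam ` (a ` T) \<and> cen (a ` T) = cen P)}"
      using a(1) w(2,4) cenP by (intro CollectI conjI exI[of _ a]) simp_all
  next
    fix lam assume "lam \<in> {lam. lam \<ge> 1 \<and> (\<exists>a. nondeg_affine a \<and> a ` T \<subseteq> P
       \<and> P \<subseteq> homothety (cen (a ` T)) lam ` (a ` T) \<and> cen (a ` T) = cen P)}"
    then obtain a where lam: "1 \<le> lam" and a: "nondeg_affine a" "a ` T \<subseteq> P"
      "P \<subseteq> homothety (cen (a ` T)) lam ` (a ` T)" "cen (a ` T) = cen P" by blast
    have "(1/3) *\<^sub>R (a p + a q + a r) = c" using aT[OF a(1)] a(4) cenP by simp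
    moreover have "convex hull {a p, a q, a r} \<subseteq> P" using a(2) aT[OF a(1)] by simp
    moreover have "P \<subseteq> homothety c lam ` (convex hull {a p, a q, a r})"
      using a(3) unfolding a(4) cenP unfolding aT(1)[OF a(1)] .
    ultimately show "5 / 2 \<le> lam" using lam indep by (intro homothety_ratio_ge[OF P, of "a p" "a q" "a r" lam]) auto
  qed
qed

end
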